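(* Let $\mathcal{G}=(\mathcal{V},\mathcal{E})$ be a finite directed graph, let $Q\in\mathbb{Z}_{\ge 0}$, let $F_v:\mathbb{R}\to\mathbb{R}$ ($v\in\mathcal{V}$) and $G_{uv}:\mathbb{R}\to\mathbb{R}$ ($uv\in\mathcal{E}$) be convex functions, and set $J(x)=\sum_{v\in\mathcal{V}}F_v(x_v)+\sum_{uv\in\mathcal{E}}G_{uv}(x_u-x_v)$. Then, from every starting point $x^{(0)}\in\{0,1,\ldots,Q\}^{\mathcal{V}}$, the connected-subgraph alternating augmentation algorithm (defined in the context) converges to a global minimizer of $J$ over $\{0,1,\ldots,Q\}^{\mathcal{V}}$; that is, it stops after finitely many iterations and returns a global minimizer.
   Context: A directed graph is $\mathcal{G}=(\mathcal{V},\mathcal{E})$ with $\mathcal{E}\subset\mathcal{V}\times\mathcal{V}$. The subgraph induced by $S\subset\mathcal{V}$ is $(S,\mathcal{E}\cap(S\times S))$; "connected" means weakly connected (edge directions ignored). $\chi_S\in\{0,1\}^{\mathcal{V}}$ is the indicator vector of $S$. Let $\mathcal{C}=\{0\}\cup\{\chi_S:\emptyset\ne S\subset\mathcal{V},\ S\text{ induces a connected subgraph of }\mathcal{G}\}$. Connected-subgraph alternating augmentation algorithm: set $k=0$ and repeat the following. (1) Choose $\Delta x^{\mathrm{up}}$ minimizing $J(x^{(k)}+\Delta x)$ over $\Delta x\in\mathcal{C}$ with $x^{(k)}+\Delta x\in\{0,\ldots,Q\}^{\mathcal{V}}$, and set $x^{(k+1)}=x^{(k)}+\Delta x^{\mathrm{up}}$.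 (2) Choose $\Delta x^{\mathrm{down}}$ minimizing $J(x^{(k+1)}-\Delta x)$ over $\Delta x\in\mathcal{C}$ with $x^{(k+1)}-\Delta x\in\{0,\ldots,Q\}^{\mathcal{V}}$, and set $x^{(k+2)}=x^{(k+1)}-\Delta x^{\mathrm{down}}$. (3) If $x^{(k+2)}=x^{(k)}$, stop and return $x^{(k)}$; otherwise replace $k$ by $k+2$. Convention: only strictly improving moves are taken, i.e. in (1) and (2) the zero move is chosen whenever it is among the minimizers; otherwise an arbitrary minimizer is chosen. *)

theory Defs
  imports
    "HOL-Analysis.Convex"
    "HOL-Library.Function_Algebras"
    "HOL-Library.Indicator_Function"
    "Graph_Theory.Digraph_Component"
begin

text \<open>
  An integer vector indexed by the vertices of \<open>G\<close> is a function \<open>'v \<Rightarrow> int\<close> that vanishes outside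
  \<open>pverts G\<close>; so equality of vectors is equality of functions, and vectors are added and subtracted
  pointwise.
\<close>

definition lattice_box :: "'v pair_pre_digraph \<Rightarrow> nat \<Rightarrow> ('v \<Rightarrow> int) set" where
  "lattice_box G Q = {x. (\<forall>v \<in> pverts G. x v \<in> {0..int Q}) \<and> (\<forall>v. v \<notin> pverts G \<longrightarrow> x v = 0)}"

definition objective ::
  "'v pair_pre_digraph \<Rightarrow> ('v \<Rightarrow> real \<Rightarrow> real) \<Rightarrow> ('v \<times> 'v \<Rightarrow> real \<Rightarrow> real) \<Rightarrow> ('v \<Rightarrow> int) \<Rightarrow> real" where
  "objective G F H x =
     (\<Sum>v \<in> pverts G. F v (real_of_int (x v))) +
     (\<Sum>(u, v) \<in> parcs G. H (u, v) (real_of_int (x u - x v)))"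

text \<open>
  \<^const>\<open>Digraph_Component.connected\<close> refers to the underlying symmetric graph, so it is weak
  connectivity.
\<close>

definition connected_increments :: "'v pair_pre_digraph \<Rightarrow> ('v \<Rightarrow> int) set" where
  "connected_increments G =
     {0} \<union> {indicator S | S. S \<noteq> {} \<and> S \<subseteq> pverts G \<and>
                            Digraph_Component.connected (with_proj G \<restriction> S)}"

text \<open>
  A minimizer of \<open>f\<close> over \<open>D\<close>, arbitrary except that the zero move is taken whenever it is itself
  a minimizer.
\<close>

definition best_move :: "(('v \<Rightarrow> int) \<Rightarrow> real) \<Rightarrow> ('v \<Rightarrow> int) set \<Rightarrow> ('v \<Rightarrow> int) \<Rightarrow> bool" where
  "best_move f D d \<longleftrightarrow>
     is_arg_min f (\<lambda>d. d \<in> D) d \<and> (is_arg_min f (\<lambda>d. d \<in> D) 0 \<longrightarrow> d = 0)"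

definition up_step ::
  "'v pair_pre_digraph \<Rightarrow> nat \<Rightarrow> (('v \<Rightarrow> int) \<Rightarrow> real) \<Rightarrow> ('v \<Rightarrow> int) \<Rightarrow> ('v \<Rightarrow> int) \<Rightarrow> bool" where
  "up_step G Q J x y \<longleftrightarrow>
     (\<exists>d. best_move (\<lambda>d. J (x + d)) {d \<in> connected_increments G. x + d \<in> lattice_box G Q} d \<and> y = x + d)"

definition down_step ::
  "'v pair_pre_digraph \<Rightarrow> nat \<Rightarrow> (('v \<Rightarrow> int) \<Rightarrow> real) \<Rightarrow> ('v \<Rightarrow> int) \<Rightarrow> ('v \<Rightarrow> int) \<Rightarrow> bool" where
  "down_step G Q J y z \<longleftrightarrow>
     (\<exists>d. best_move (\<lambda>d. J (y - d)) {d \<in> connected_increments G. y - d \<in> lattice_box G Q} d \<and> z = y - d)"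

text \<open>
  One pass of the loop, from the iterate with index \<open>k\<close> to the one with index \<open>k + 2\<close>. The algorithm
  is nondeterministic, hence a relation. A pass leading back to its start makes the algorithm stop
  and return that point; any other pass makes it continue.
\<close>

definition iteration ::
  "'v pair_pre_digraph \<Rightarrow> nat \<Rightarrow> (('v \<Rightarrow> int) \<Rightarrow> real) \<Rightarrow> ('v \<Rightarrow> int) \<Rightarrow> ('v \<Rightarrow> int) \<Rightarrow> bool" where
  "iteration G Q J x z \<longleftrightarrow> (\<exists>y. up_step G Q J x y \<and> down_step G Q J y z)"

definition continues ::
  "'v pair_pre_digraph \<Rightarrow> nat \<Rightarrow> (('v \<Rightarrow> int) \<Rightarrow> real) \<Rightarrow> ('v \<Rightarrow> int) \<Rightarrow> ('v \<Rightarrow> int) \<Rightarrow> bool" where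
  "continues G Q J x z \<longleftrightarrow> iteration G Q J x z \<and> z \<noteq> x"

definition reaches ::
  "'v pair_pre_digraph \<Rightarrow> nat \<Rightarrow> (('v \<Rightarrow> int) \<Rightarrow> real) \<Rightarrow> ('v \<Rightarrow> int) \<Rightarrow> ('v \<Rightarrow> int) \<Rightarrow> bool" where
  "reaches G Q J = (continues G Q J)\<^sup>*\<^sup>*"

definition returns ::
  "'v pair_pre_digraph \<Rightarrow> nat \<Rightarrow> (('v \<Rightarrow> int) \<Rightarrow> real) \<Rightarrow> ('v \<Rightarrow> int) \<Rightarrow> ('v \<Rightarrow> int) \<Rightarrow> bool" where
  "returns G Q J x0 x \<longleftrightarrow> reaches G Q J x0 x \<and> iteration G Q J x x"

text \<open>
  Every execution from \<open>x0\<close> stops after finitely many iterations: the minimizations that define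
  the next moves can always be carried out, and no execution continues forever.
\<close>

definition always_stops ::
  "'v pair_pre_digraph \<Rightarrow> nat \<Rightarrow> (('v \<Rightarrow> int) \<Rightarrow> real) \<Rightarrow> ('v \<Rightarrow> int) \<Rightarrow> bool" where
  "always_stops G Q J x0 \<longleftrightarrow>
     (\<forall>x. reaches G Q J x0 x \<longrightarrow>
        (\<exists>y. up_step G Q J x y) \<and> (\<forall>y. up_step G Q J x y \<longrightarrow> (\<exists>z. down_step G Q J y z))) \<and>
     \<not> (\<exists>s :: nat \<Rightarrow> 'v \<Rightarrow> int. s 0 = x0 \<and> (\<forall>i. continues G Q J (s i) (s (Suc i))))"

end

theory Submission
  imports Defs
begin

text \<open>
  If \<open>x\<close> cannot be improved by adding or subtracting the indicator of a connected set, then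
  \<open>J x \<le> J y\<close> for every \<open>y\<close> in the box, by induction on the \<open>\<ell>\<^sub>1\<close>-distance of \<open>x\<close> and \<open>y\<close>. Say \<open>y v > x v\<close>
  for some \<open>v\<close>, and let \<open>S\<close> be a connected component of the subgraph induced by the set on which
  \<open>y - x\<close> is maximal. Convexity of the \<open>F v\<close> and \<open>H (u, v)\<close> gives the exchange inequality
  \<open>J (x + \<chi>\<^sub>S) + J (y - \<chi>\<^sub>S) \<le> J x + J y\<close>. Since \<open>J x \<le> J (x + \<chi>\<^sub>S)\<close>, it follows that
  \<open>J (y - \<chi>\<^sub>S) \<le> J y\<close>, and \<open>y - \<chi>\<^sub>S\<close> is closer to \<open>x\<close>. A pass that moves strictly decreases
  \<open>J\<close>, so the algorithm stops, and it does so where neither direction admits an improvement.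
\<close>

section \<open>Convexity and the exchange inequality\<close>

text \<open>The points \<open>s + d\<close> and \<open>t - d\<close> are convex combinations of
  \<open>s\<close> and \<open>t\<close> with mirrored weights, so in the sum of the two convexity
  inequalities \<open>f s\<close> and \<open>f t\<close> each get total weight 1.\<close>

lemma convex_on_inward_shift:
  fixes f :: "real \<Rightarrow> real"
  assumes f: "convex_on UNIV f" and "0 \<le> d" "d \<le> t - s"
  shows "f (s + d) + f (t - d) \<le> f s + f t"
proof (cases "s = t")
  case True
  then show ?thesis using assms by simp
next
  case False
  define a where "a = d / (t - s)"
  have a: "0 \<le> a" "a \<le> 1" using assms False by (auto simp: a_def divide_simps)
  have d: "d = a * (t - s)" using False by (simp add: a_def)
  have "f ((1 - a) * s + a * t) \<le> (1 - a) * f s + a * f t"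
    using convex_onD[OF f a, of s t] by simp
  moreover have "f ((1 - a) * t + a * s) \<le> (1 - a) * f t + a * f s"
    using convex_onD[OF f a, of t s] by simp
  moreover have "(1 - a) * s + a * t = s + d" "(1 - a) * t + a * s = t - d"
    by (auto simp: d algebra_simps)
  ultimately show ?thesis by (simp add: algebra_simps)
qed

text \<open>The component comes from minimality: among the nonempty subsets of \<open>A\<close> that
  no arc within \<open>A\<close> enters or leaves, one of least cardinality is connected, since the
  vertices reachable from any of its points form another such subset.\<close>

lemma obtain_component:
  fixes G :: "'v pair_pre_digraph"
  assumes "finite A" "A \<noteq> {}"
  obtains S where "S \<noteq> {}" "S \<subseteq> A" "Digraph_Component.connected (with_proj G \<restriction> S)"
    "\<And>u v. (u, v) \<in> parcs G \<Longrightarrow> u \<in> A \<Longrightarrow> v \<in> A \<Longrightarrow> u \<in> S \<longleftrightarrow> v \<in> S"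
proof -
  define closed_in where
    "closed_in = (\<lambda>S. \<forall>(u, v) \<in> parcs G. u \<in> A \<longrightarrow> v \<in> A \<longrightarrow> (u \<in> S \<longleftrightarrow> v \<in> S))"
  let ?P = "\<lambda>S. S \<noteq> {} \<and> S \<subseteq> A \<and> closed_in S"
  have "?P A" using assms by (auto simp: closed_in_def)
  then obtain S where S: "?P S" and min: "\<And>T. ?P T \<Longrightarrow> card S \<le> card T"
    using ex_has_least_nat[of ?P A card] by blast
  let ?E = "mk_symmetric (with_proj G \<restriction> S)"
  have E: "(u, v) \<in> parcs ?E \<longleftrightarrow> u \<in> S \<and> v \<in> S \<and> ((u, v) \<in> parcs G \<or> (v, u) \<in> parcs G)" for u v
    by (auto simp: parcs_mk_symmetric)
  have reach: "u \<rightarrow>\<^sup>*\<^bsub>with_proj ?E\<^esub> v" if "u \<in> S" "v \<in> S" for u v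
  proof -
    let ?R = "{w. u \<rightarrow>\<^sup>*\<^bsub>with_proj ?E\<^esub> w}"
    have sub: "?R \<subseteq> S" by (auto elim: reachable_in_vertsE)
    have step: "b \<in> ?R" if "a \<in> ?R" "(a, b) \<in> parcs ?E" for a b
    proof -
      have "b \<in> S" using that(2) E by blast
      then have "(u, b) \<in> rtrancl_on S (parcs ?E)"
        using that by (simp add: reachable_def rtrancl_on_into_rtrancl_on[of u a])
      then show ?thesis by (simp add: reachable_def)
    qed
    have "a \<in> ?R \<longleftrightarrow> b \<in> ?R" if "(a, b) \<in> parcs G" "a \<in> A" "b \<in> A" for a b
    proof -
      have "a \<in> S \<longleftrightarrow> b \<in> S" using S that by (auto simp: closed_in_def)
      \<comment> \<open>If one end lies in \<open>?R\<close>, it lies in \<open>S\<close>, hence so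
        does the other end, and symmetrization makes the arc usable both ways.\<close>
      then have "a \<in> ?R \<or> b \<in> ?R \<Longrightarrow> (a, b) \<in> parcs ?E \<and> (b, a) \<in> parcs ?E"
        using sub that E by blast
      then show ?thesis using step by blast
    qed
    moreover have "u \<in> ?R" using \<open>u \<in> S\<close> by (simp add: reachable_def)
    ultimately have "?P ?R" using sub S by (auto simp: closed_in_def)
    then have "card S \<le> card ?R" by (rule min)
    moreover have "finite S" using S assms finite_subset by blast
    ultimately have "?R = S" using sub by (simp add: card_seteq)
    then show ?thesis using \<open>v \<in> S\<close> by blast
  qed
  have "Digraph_Component.connected (with_proj G \<restriction> S)"
    using S reach by (auto simp: connected_def strongly_connected_def)
  then show ?thesis using that[of S] S by (auto simp: closed_in_def)
qed

text \<open>The inequality holds term by term. An arc with both ends on the same side of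
  \<open>S\<close> keeps its differences; on a crossing arc \<open>edge\<close> orders the
  differences of \<open>x\<close> and \<open>y\<close> so that each moves one step towards the
  other.\<close>

lemma objective_exchange:
  fixes G :: "'v pair_pre_digraph"
  assumes F: "\<And>v. v \<in> pverts G \<Longrightarrow> convex_on UNIV (F v)"
    and H: "\<And>u v. (u, v) \<in> parcs G \<Longrightarrow> convex_on UNIV (H (u, v))"
    and less: "\<And>v. v \<in> S \<Longrightarrow> x v < y v"
    and edge: "\<And>u v. (u, v) \<in> parcs G \<Longrightarrow> u \<in> S \<Longrightarrow> v \<notin> S \<Longrightarrow> y v - x v < y u - x u"
      "\<And>u v. (u, v) \<in> parcs G \<Longrightarrow> v \<in> S \<Longrightarrow> u \<notin> S \<Longrightarrow> y u - x u < y v - x v"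
  shows "objective G F H (x + indicator S) + objective G F H (y - indicator S)
    \<le> objective G F H x + objective G F H y"
proof -
  let ?x = "x + indicator S" and ?y = "y - indicator S"
  \<comment> \<open>Distinct integers are at least 1 apart, which is the room that an inward shift
    by 1 needs.\<close>
  have convex_step: "f (of_int (s + 1)) + f (of_int (t - 1)) \<le> f (of_int s) + f (of_int t)"
    if "convex_on UNIV f" "s < t" for f :: "real \<Rightarrow> real" and s t :: int
    using convex_on_inward_shift[OF that(1), of 1 "of_int t" "of_int s"] that(2) by simp
  have V: "(\<Sum>v\<in>pverts G. F v (?x v) + F v (?y v)) \<le> (\<Sum>v\<in>pverts G. F v (x v) + F v (y v))"
  proof (rule sum_mono)
    fix v assume "v \<in> pverts G"
    then show "F v (?x v) + F v (?y v) \<le> F v (x v) + F v (y v)"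
      using convex_step[OF F less] by (cases "v \<in> S") auto
  qed
  have "H (u, v) (?x u - ?x v) + H (u, v) (?y u - ?y v) \<le> H (u, v) (x u - x v) + H (u, v) (y u - y v)"
    if uv: "(u, v) \<in> parcs G" for u v
  proof -
    consider "u \<in> S \<longleftrightarrow> v \<in> S" | "u \<in> S" "v \<notin> S" | "u \<notin> S" "v \<in> S" by blast
    then show ?thesis
    proof cases
      case 1
      then have "?x u - ?x v = x u - x v" "?y u - ?y v = y u - y v"
        by (auto simp: indicator_def)
      then show ?thesis by simp
    next
      case 2
      then have "?x u - ?x v = (x u - x v) + 1" "?y u - ?y v = (y u - y v) - 1" by auto
      moreover have "x u - x v < y u - y v" using edge(1)[OF uv] 2 by simp
      ultimately show ?thesis using convex_step[OF H[OF uv]] by metis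
    next
      case 3
      then have "?x u - ?x v = (x u - x v) - 1" "?y u - ?y v = (y u - y v) + 1" by auto
      \<comment> \<open>Now \<open>x\<close> has the larger difference, so
        \<open>convex_step\<close> is used with \<open>x\<close> and \<open>y\<close>
        exchanged.\<close>
      moreover have "y u - y v < x u - x v" using edge(2)[OF uv] 3 by simp
      ultimately show ?thesis using convex_step[OF H[OF uv]] by (metis add.commute)
    qed
  qed
  then have "(\<Sum>(u, v)\<in>parcs G. H (u, v) (?x u - ?x v) + H (u, v) (?y u - ?y v))
      \<le> (\<Sum>(u, v)\<in>parcs G. H (u, v) (x u - x v) + H (u, v) (y u - y v))"
    by (intro sum_mono) auto
  with V show ?thesis
    by (simp add: objective_def sum.distrib case_prod_unfold del: plus_fun_apply minus_apply)
qed

text \<open>The maximality of \<open>y - x\<close> on \<open>A\<close> supplies the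
  \<open>edge\<close> hypotheses of \<open>objective_exchange\<close>: an arc crossing
  \<open>S\<close> must have its other end outside \<open>A\<close>.\<close>

lemma connected_exchange:
  fixes G :: "'v pair_pre_digraph"
  assumes G: "pair_fin_digraph G"
    and F: "\<And>v. v \<in> pverts G \<Longrightarrow> convex_on UNIV (F v)"
    and H: "\<And>u v. (u, v) \<in> parcs G \<Longrightarrow> convex_on UNIV (H (u, v))"
    and x: "x \<in> lattice_box G Q" and y: "y \<in> lattice_box G Q"
    and less: "x w < y w"
  obtains S where "S \<noteq> {}" "S \<subseteq> pverts G" "indicator S \<in> connected_increments G"
    "\<And>v. v \<in> S \<Longrightarrow> x v < y v"
    "x + indicator S \<in> lattice_box G Q" "y - indicator S \<in> lattice_box G Q"
    "objective G F H (x + indicator S) + objective G F H (y - indicator S)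
      \<le> objective G F H x + objective G F H y"
proof -
  interpret pair_fin_digraph G by fact
  \<comment> \<open>Both vectors vanish outside \<open>pverts G\<close>, so they can differ only at
    vertices.\<close>
  have w: "w \<in> pverts G" using x y less by (force simp: lattice_box_def)
  define m where "m = Max ((\<lambda>v. y v - x v) ` pverts G)"
  have m: "y v - x v \<le> m" if "v \<in> pverts G" for v
    using that by (auto simp: m_def intro!: Max_ge)
  define A where "A = {v \<in> pverts G. y v - x v = m}"
  have "m \<in> (\<lambda>v. y v - x v) ` pverts G" unfolding m_def using w by (intro Max_in) auto
  then have "A \<noteq> {}" by (auto simp: A_def)
  moreover have "finite A" by (simp add: A_def)
  ultimately obtain S where S: "S \<noteq> {}" "S \<subseteq> A" "Digraph_Component.connected (with_proj G \<restriction> S)"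
    and edge: "\<And>u v. (u, v) \<in> parcs G \<Longrightarrow> u \<in> A \<Longrightarrow> v \<in> A \<Longrightarrow> u \<in> S \<longleftrightarrow> v \<in> S"
    using obtain_component by metis
  have SV: "S \<subseteq> pverts G" using S by (auto simp: A_def)
  \<comment> \<open>The maximum \<open>m\<close> is at least \<open>y w - x w\<close>, hence
    positive.\<close>
  have less_S: "x v < y v" if "v \<in> S" for v
    using that S m[OF w] less by (auto simp: A_def)
  have strict: "y v - x v < y u - x u" if "u \<in> S" "v \<in> pverts G" "v \<notin> A" for u v
    using that S m[of v] by (auto simp: A_def)
  have ends: "u \<in> pverts G \<and> v \<in> pverts G" if "(u, v) \<in> parcs G" for u v
    using that wellformed[of "(u, v)"] by auto
  show ?thesis
  proof (assumption | rule that)+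
    show "S \<noteq> {}" "S \<subseteq> pverts G" "\<And>v. v \<in> S \<Longrightarrow> x v < y v" by fact+
    show "indicator S \<in> connected_increments G"
      using S SV by (auto simp: connected_increments_def)
    \<comment> \<open>On \<open>S\<close>, integrality keeps \<open>x v + 1\<close> and
      \<open>y v - 1\<close> between \<open>x v\<close> and \<open>y v\<close>.\<close>
    show "x + indicator S \<in> lattice_box G Q" "y - indicator S \<in> lattice_box G Q"
      using x y SV less_S by (fastforce simp: lattice_box_def indicator_def)+
    show "objective G F H (x + indicator S) + objective G F H (y - indicator S)
      \<le> objective G F H x + objective G F H y"
    proof (rule objective_exchange[where F = F and H = H, OF F H less_S])
      \<comment> \<open>If \<open>v\<close> were in \<open>A\<close>, then \<open>edge\<close> would
        put it into \<open>S\<close>.\<close>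
      show "y v - x v < y u - x u" if "(u, v) \<in> parcs G" "u \<in> S" "v \<notin> S" for u v
        using that edge[of u v] S ends[of u v] by (intro strict) auto
      show "y u - x u < y v - x v" if "(u, v) \<in> parcs G" "v \<in> S" "u \<notin> S" for u v
        using that edge[of u v] S ends[of u v] by (intro strict) auto
    qed
  qed
qed

section \<open>From local to global optimality\<close>

lemma local_optimum_is_global:
  fixes G :: "'v pair_pre_digraph" and x y :: "'v \<Rightarrow> int"
  assumes G: "pair_fin_digraph G"
    and F: "\<And>v. v \<in> pverts G \<Longrightarrow> convex_on UNIV (F v)"
    and H: "\<And>u v. (u, v) \<in> parcs G \<Longrightarrow> convex_on UNIV (H (u, v))"
    and x: "x \<in> lattice_box G Q"
    and up: "\<And>d. d \<in> connected_increments G \<Longrightarrow> x + d \<in> lattice_box G Q \<Longrightarrow>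
      objective G F H x \<le> objective G F H (x + d)"
    and down: "\<And>d. d \<in> connected_increments G \<Longrightarrow> x - d \<in> lattice_box G Q \<Longrightarrow>
      objective G F H x \<le> objective G F H (x - d)"
    and y: "y \<in> lattice_box G Q"
  shows "objective G F H x \<le> objective G F H y"
  using y
proof (induction "\<Sum>v\<in>pverts G. nat \<bar>y v - x v\<bar>" arbitrary: y rule: less_induct)
  case less
  interpret pair_fin_digraph G by fact
  have closer: "(\<Sum>v\<in>pverts G. nat \<bar>z v - x v\<bar>) < (\<Sum>v\<in>pverts G. nat \<bar>y v - x v\<bar>)"
    if "S \<noteq> {}" "S \<subseteq> pverts G" "\<And>v. v \<in> S \<Longrightarrow> \<bar>z v - x v\<bar> < \<bar>y v - x v\<bar>"
      "\<And>v. v \<notin> S \<Longrightarrow> z v = y v" for z S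
  proof (rule sum_strict_mono_ex1)
    show "\<forall>v\<in>pverts G. nat \<bar>z v - x v\<bar> \<le> nat \<bar>y v - x v\<bar>"
      using that(3,4) by (metis nat_mono order.strict_implies_order order_refl)
    show "\<exists>v\<in>pverts G. nat \<bar>z v - x v\<bar> < nat \<bar>y v - x v\<bar>"
      using that(1-3) by fastforce
  qed simp
  consider "x = y" | w where "x w < y w" | w where "y w < x w"
    by (metis ext linorder_neqE)
  then show ?case
  proof cases
    case 1
    then show ?thesis by simp
  next
    case 2
    obtain S where S: "S \<noteq> {}" "S \<subseteq> pverts G" "indicator S \<in> connected_increments G"
      "\<And>v. v \<in> S \<Longrightarrow> x v < y v"
      "x + indicator S \<in> lattice_box G Q" "y - indicator S \<in> lattice_box G Q"
      "objective G F H (x + indicator S) + objective G F H (y - indicator S)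
        \<le> objective G F H x + objective G F H y"
      by (rule connected_exchange[where F = F and H = H, OF G F H x less.prems 2])
        (assumption | rule that)+
    have "objective G F H x \<le> objective G F H (y - indicator S)"
      using S(4) by (intro less.hyps closer[OF S(1,2)] S(6)) force+
    with S(7) up[OF S(3,5)] show ?thesis by simp
  next
    \<comment> \<open>In the mirror case \<open>x\<close> is the vector that loses
      \<open>indicator S\<close>, so \<open>down\<close> takes the place of
      \<open>up\<close>.\<close>
    case 3
    obtain S where S: "S \<noteq> {}" "S \<subseteq> pverts G" "indicator S \<in> connected_increments G"
      "\<And>v. v \<in> S \<Longrightarrow> y v < x v"
      "y + indicator S \<in> lattice_box G Q" "x - indicator S \<in> lattice_box G Q"
      "objective G F H (y + indicator S) + objective G F H (x - indicator S)
        \<le> objective G F H y + objective G F H x"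
      by (rule connected_exchange[where F = F and H = H, OF G F H less.prems x 3])
        (assumption | rule that)+
    have "objective G F H x \<le> objective G F H (y + indicator S)"
      using S(4) by (intro less.hyps closer[OF S(1,2)] S(5)) force+
    with S(7) down[OF S(3,6)] show ?thesis by simp
  qed
qed

section \<open>Existence and properties of single moves\<close>

lemma finite_lattice_box:
  assumes "finite (pverts G)"
  shows "finite (lattice_box G Q)"
  using finite_set_of_finite_funs[OF assms, of "{0..int Q}" 0]
  by (rule rev_finite_subset) (auto simp: lattice_box_def)

lemma finite_connected_increments:
  assumes "finite (pverts G)"
  shows "finite (connected_increments G)"
proof (rule finite_subset)
  show "connected_increments G \<subseteq> insert 0 (indicator ` Pow (pverts G))"
    by (auto simp: connected_increments_def)
qed (use assms in simp)

lemma zero_in_connected_increments: "0 \<in> connected_increments G"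
  by (simp add: connected_increments_def)

lemma best_move_exists:
  assumes "finite D" "0 \<in> D"
  shows "\<exists>d. best_move f D d"
proof -
  obtain d where "is_arg_min f (\<lambda>d. d \<in> D) d"
    using ex_is_arg_min_if_finite[of D f] assms by auto
  \<comment> \<open>The witness is 0 if 0 is a minimizer; otherwise any minimizer will do.\<close>
  then show ?thesis unfolding best_move_def by metis
qed

lemma best_moveD:
  assumes "best_move f D d"
  shows "d \<in> D" "e \<in> D \<Longrightarrow> f d \<le> f e" "0 \<in> D \<Longrightarrow> d = 0 \<or> f d < f 0"
proof -
  show d: "d \<in> D" and le: "e \<in> D \<Longrightarrow> f d \<le> f e" for e
    using assms by (auto simp: best_move_def is_arg_min_linorder)
  \<comment> \<open>The convention on zero moves enters here: if \<open>d\<close> is nonzero, then 0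
    is feasible but not a minimizer.\<close>
  show "d = 0 \<or> f d < f 0" if "0 \<in> D"
    using assms that le by (force simp: best_move_def is_arg_min_linorder)
qed

lemma up_step_exists:
  assumes "finite (pverts G)" "x \<in> lattice_box G Q"
  shows "\<exists>y. up_step G Q J x y"
  using best_move_exists[of "{d \<in> connected_increments G. x + d \<in> lattice_box G Q}"]
    finite_connected_increments[OF assms(1)] zero_in_connected_increments assms(2)
  by (simp add: up_step_def) blast

lemma down_step_exists:
  assumes "finite (pverts G)" "y \<in> lattice_box G Q"
  shows "\<exists>z. down_step G Q J y z"
  using best_move_exists[of "{d \<in> connected_increments G. y - d \<in> lattice_box G Q}"]
    finite_connected_increments[OF assms(1)] zero_in_connected_increments assms(2)
  by (simp add: down_step_def) blast

lemma up_stepD: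
  assumes "up_step G Q J x y" "x \<in> lattice_box G Q"
  shows "y \<in> lattice_box G Q" "y = x \<or> J y < J x"
    "d \<in> connected_increments G \<Longrightarrow> x + d \<in> lattice_box G Q \<Longrightarrow> J y \<le> J (x + d)"
proof -
  let ?D = "{d \<in> connected_increments G. x + d \<in> lattice_box G Q}"
  obtain e where e: "best_move (\<lambda>d. J (x + d)) ?D e" and y: "y = x + e"
    using assms(1) by (auto simp: up_step_def)
  have "0 \<in> ?D" using assms(2) zero_in_connected_increments by simp
  then show "y = x \<or> J y < J x" using best_moveD(3)[OF e] y by auto
  show "y \<in> lattice_box G Q" using best_moveD(1)[OF e] y by simp
  show "J y \<le> J (x + d)" if "d \<in> connected_increments G" "x + d \<in> lattice_box G Q"
    using best_moveD(2)[OF e, of d] y that by simp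
qed

lemma down_stepD:
  assumes "down_step G Q J y z" "y \<in> lattice_box G Q"
  shows "z \<in> lattice_box G Q" "z = y \<or> J z < J y"
    "d \<in> connected_increments G \<Longrightarrow> y - d \<in> lattice_box G Q \<Longrightarrow> J z \<le> J (y - d)"
proof -
  let ?D = "{d \<in> connected_increments G. y - d \<in> lattice_box G Q}"
  obtain e where e: "best_move (\<lambda>d. J (y - d)) ?D e" and z: "z = y - e"
    using assms(1) by (auto simp: down_step_def)
  have "0 \<in> ?D" using assms(2) zero_in_connected_increments by simp
  then show "z = y \<or> J z < J y" using best_moveD(3)[OF e] z by auto
  show "z \<in> lattice_box G Q" using best_moveD(1)[OF e] z by simp
  show "J z \<le> J (y - d)" if "d \<in> connected_increments G" "y - d \<in> lattice_box G Q"
    using best_moveD(2)[OF e, of d] z that by simp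
qed

section \<open>Descent, termination and the stopping point\<close>

text \<open>If \<open>z\<close> differs from \<open>x\<close>, at least one of the two half steps
  moves, and a half step that moves strictly lowers \<open>J\<close>.\<close>

lemma continuesD:
  assumes "continues G Q J x z" "x \<in> lattice_box G Q"
  shows "z \<in> lattice_box G Q" "J z < J x"
proof -
  obtain y where y: "up_step G Q J x y" "down_step G Q J y z" and "z \<noteq> x"
    using assms by (auto simp: continues_def iteration_def)
  note up = up_stepD[OF y(1) assms(2)]
  note down = down_stepD[OF y(2) up(1)]
  show "z \<in> lattice_box G Q" by (rule down)
  show "J z < J x" using up(2) down(2) \<open>z \<noteq> x\<close> by auto
qed

lemma reaches_in_lattice_box:
  assumes "reaches G Q J x z" "x \<in> lattice_box G Q"
  shows "z \<in> lattice_box G Q"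
  using assms unfolding reaches_def by (induction rule: rtranclp_induct) (auto dest: continuesD)

text \<open>The zero move is always feasible, so no minimization fails; an infinite run would visit
  infinitely many distinct points of a finite box.\<close>

lemma always_stops:
  assumes fin: "finite (pverts G)" and x0: "x0 \<in> lattice_box G Q"
  shows "always_stops G Q J x0"
  unfolding always_stops_def
proof (intro conjI allI impI notI)
  fix x assume "reaches G Q J x0 x"
  then have x: "x \<in> lattice_box G Q" using x0 by (rule reaches_in_lattice_box)
  show "\<exists>y. up_step G Q J x y" by (rule up_step_exists[OF fin x])
  show "\<exists>z. down_step G Q J y z" if "up_step G Q J x y" for y
    by (rule down_step_exists[OF fin up_stepD(1)[OF that x]])
next
  assume "\<exists>s :: nat \<Rightarrow> _. s 0 = x0 \<and> (\<forall>i. continues G Q J (s i) (s (Suc i)))"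
  then obtain s :: "nat \<Rightarrow> _" where s0: "s 0 = x0" and s: "\<And>i. continues G Q J (s i) (s (Suc i))"
    by blast
  have box: "s i \<in> lattice_box G Q" for i
    by (induction i) (auto simp: s0 x0 intro: continuesD(1)[OF s])
  have "J (s j) < J (s i)" if "i < j" for i j
    using that by (induction rule: less_Suc_induct) (auto intro: continuesD(2)[OF s box])
  then have "inj s" by (metis injI less_irrefl linorder_neqE_nat)
  moreover have "finite (range s)"
    using finite_lattice_box[OF fin] by (rule rev_finite_subset) (use box in auto)
  ultimately show False using finite_imageD by blast
qed

text \<open>A nonzero up move would lower \<open>J\<close>, and the way back to \<open>x\<close>
  would have to lower it again. So both half steps stay at \<open>x\<close>, and both minimality
  conditions hold at this one point.\<close>

lemma iteration_fixpoint:
  assumes "iteration G Q J x x" "x \<in> lattice_box G Q"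
  shows "up_step G Q J x x" "down_step G Q J x x"
proof -
  obtain y where y: "up_step G Q J x y" "down_step G Q J y x"
    using assms by (auto simp: iteration_def)
  note up = up_stepD[OF y(1) assms(2)]
  have "y = x" using up(2) down_stepD(2)[OF y(2) up(1)] by auto
  with y show "up_step G Q J x x" "down_step G Q J x x" by auto
qed

theorem corollary5:
  fixes G :: "'v pair_pre_digraph"
    and Q :: nat
    and F :: "'v \<Rightarrow> real \<Rightarrow> real"
    and H :: "'v \<times> 'v \<Rightarrow> real \<Rightarrow> real"
    and x0 :: "'v \<Rightarrow> int"
  assumes "pair_fin_digraph G"
    and "\<And>v. v \<in> pverts G \<Longrightarrow> convex_on UNIV (F v)"
    and "\<And>u v. (u, v) \<in> parcs G \<Longrightarrow> convex_on UNIV (H (u, v))"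
    and "x0 \<in> lattice_box G Q"
  shows "always_stops G Q (objective G F H) x0 \<and>
         (\<forall>x. returns G Q (objective G F H) x0 x \<longrightarrow>
              is_arg_min (objective G F H) (\<lambda>y. y \<in> lattice_box G Q) x)"
proof (intro conjI allI impI)
  interpret pair_fin_digraph G by fact
  show "always_stops G Q (objective G F H) x0"
    by (rule always_stops[OF _ assms(4)]) simp
  fix x assume "returns G Q (objective G F H) x0 x"
  then have x: "x \<in> lattice_box G Q" and it: "iteration G Q (objective G F H) x x"
    using reaches_in_lattice_box[OF _ assms(4)] by (auto simp: returns_def)
  note fixpoint = iteration_fixpoint[OF it x]
  have "objective G F H x \<le> objective G F H y" if "y \<in> lattice_box G Q" for y
    \<comment> \<open>Since both half steps end at \<open>x\<close>, their minimality clauses are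
      the hypotheses \<open>up\<close> and \<open>down\<close>.\<close>
    by (rule local_optimum_is_global[where F = F and H = H, OF assms(1-3) x up_stepD(3)[OF fixpoint(1) x]
          down_stepD(3)[OF fixpoint(2) x] that])
  with x show "is_arg_min (objective G F H) (\<lambda>y. y \<in> lattice_box G Q) x"
    by (simp add: is_arg_min_linorder)
qed

end
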